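(* Let $H_1,H_2$ be complex Hilbert spaces and let $\mathcal{M}$ be a linear subspace of $\mathcal{B}(H_1,H_2)$. The following assertions are equivalent. (i) $\mathcal{M}$ is a reflexive space. (ii) There exists a map $\Psi=(\psi_1,\psi_2): Bil(\mathcal{M})\to Bil(\mathcal{M})$ such that $P\leq \psi_1(P,Q)$ and $Q\leq \psi_2(P,Q)$ for any pair $(P,Q)\in Bil(\mathcal{M})$, and $$\mathcal{M}=\{T\in \mathcal{B}(H_1,H_2):\ \psi_2(P,Q)\,T\,\psi_1(P,Q)=0\ \text{for all}\ (P,Q)\in Bil(\mathcal{M})\}.$$ (iii) There exists a map $\psi_1: Lat(\mathcal{B}_{\mathcal{M}})^{\perp}\to Lat(\mathcal{A}_{\mathcal{M}})$ such that $P\leq \psi_1(Q)$ for any pair $(P,Q)\in Bil(\mathcal{M})$, and $$\mathcal{M}=\{T\in \mathcal{B}(H_1,H_2):\ Q\,T\,\psi_1(Q)=0\ \text{for all}\ Q\in Lat(\mathcal{B}_{\mathcal{M}})^{\perp}\}.$$ (iv) There exists a map $\psi_2: Lat(\mathcal{A}_{\mathcal{M}})\to Lat(\mathcal{B}_{\mathcal{M}})^{\perp}$ such that $Q\leq \psi_2(P)$ for any pair $(P,Q)\in Bil(\mathcal{M})$, and $$\mathcal{M}=\{T\in \mathcal{B}(H_1,H_2):\ \psi_2(P)\,T\,P=0\ \text{for all}\ P\in Lat(\mathcal{A}_{\mathcal{M}})\}.$$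
   Context: $\mathcal{B}(H_1,H_2)$ is the space of bounded linear operators from $H_1$ to $H_2$, and $\mathcal{B}(H)=\mathcal{B}(H,H)$. $\mathcal{P}(H)$ is the set of orthogonal projections on $H$, ordered by $P_1\leq P_2$ iff $P_1H\subseteq P_2H$; $P^\perp=I-P$. For $\mathcal{U}\subseteq\mathcal{B}(H)$, $Lat(\mathcal{U})=\{P\in\mathcal{P}(H): P^\perp TP=0\ \text{for all}\ T\in\mathcal{U}\}$, and $Lat(\mathcal{U})^\perp=\{P^\perp: P\in Lat(\mathcal{U})\}$. For a linear subspace $\mathcal{M}\subseteq\mathcal{B}(H_1,H_2)$: $\mathcal{A}_{\mathcal{M}}=\{A\in\mathcal{B}(H_1): TA\in\mathcal{M}\ \text{for all}\ T\in\mathcal{M}\}$ and $\mathcal{B}_{\mathcal{M}}=\{B\in\mathcal{B}(H_2): BT\in\mathcal{M}\ \text{for all}\ T\in\mathcal{M}\}$; $BIL(\mathcal{M})=\{(P,Q)\in\mathcal{P}(H_1)\times\mathcal{P}(H_2): QTP=0\ \text{for any}\ T\in\mathcal{M}\}$; $Bil(\mathcal{M})=BIL(\mathcal{M})\cap\bigl(Lat(\mathcal{A}_{\mathcal{M}})\times Lat(\mathcal{B}_{\mathcal{M}})^\perp\bigr)$. For a non-empty family $\mathcal{F}\subseteq\mathcal{P}(H_1)\times\mathcal{P}(H_2)$, $Op(\mathcal{F})=\{T\in\mathcal{B}(H_1,H_2): QTP=0\ \text{for all}\ (P,Q)\in\mathcal{F}\}$. The subspace $\mathcal{M}$ is called reflexive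 if $Op(BIL(\mathcal{M}))=\mathcal{M}$; equivalently, if $\mathcal{M}$ equals its reflexive cover $Ref(\mathcal{M})=\{S\in\mathcal{B}(H_1,H_2): Sx\in\overline{\mathcal{M}x}\ \text{for all}\ x\in H_1\}$ (it is a known fact that $Op(BIL(\mathcal{M}))=Ref(\mathcal{M})$). *)

theory Defs
  imports "HOL-Analysis.Analysis"
begin

(* A complex inner product space carries its underlying real inner product space as a superclass,
   so that norm, topology and bounded real-linear maps are those of HOL-Analysis.
   Positive definiteness of cinner is inherited from inner through inner_eq_Re_cinner. *)

class complex_inner = real_inner +
  fixes scaleC :: "complex \<Rightarrow> 'a \<Rightarrow> 'a" (infixr "*\<^sub>C" 75)
    and cinner :: "'a \<Rightarrow> 'a \<Rightarrow> complex"
  assumes scaleC_add_right: "c *\<^sub>C (x + y) = c *\<^sub>C x + c *\<^sub>C y"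
    and scaleC_add_left: "(c + d) *\<^sub>C x = c *\<^sub>C x + d *\<^sub>C x"
    and scaleC_scaleC: "c *\<^sub>C d *\<^sub>C x = (c * d) *\<^sub>C x"
    and scaleR_scaleC: "r *\<^sub>R x = complex_of_real r *\<^sub>C x"
    and cinner_commute: "cinner x y = cnj (cinner y x)"
    and cinner_add_left: "cinner (x + y) z = cinner x z + cinner y z"
    and cinner_scaleC_left: "cinner (c *\<^sub>C x) y = c * cinner x y"
    and inner_eq_Re_cinner: "inner x y = Re (cinner x y)"

class chilbert_space = complex_inner + complete_space

instantiation complex :: chilbert_space
begin

definition scaleC_complex :: "complex \<Rightarrow> complex \<Rightarrow> complex"
  where "scaleC_complex c x = c * x"

definition cinner_complex :: "complex \<Rightarrow> complex \<Rightarrow> complex"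
  where "cinner_complex x y = x * cnj y"

instance
  by standard
    (auto simp: scaleC_complex_def cinner_complex_def algebra_simps scaleR_conv_of_real
      inner_complex_def)

end

lemma norm_scaleC: "norm (c *\<^sub>C (x :: 'a::complex_inner)) = cmod c * norm x"
proof -
  have "cinner (c *\<^sub>C x) (c *\<^sub>C x) = c * cnj (c * cinner x x)"
    by (metis cinner_commute cinner_scaleC_left)
  also have "\<dots> = (c * cnj c) * cinner x x"
    by (metis cinner_commute complex_cnj_mult mult.assoc)
  also have "\<dots> = complex_of_real ((cmod c)\<^sup>2) * cinner x x"
    by (simp only: complex_norm_square)
  finally have "inner (c *\<^sub>C x) (c *\<^sub>C x) = (cmod c)\<^sup>2 * inner x x"
    by (simp add: inner_eq_Re_cinner)
  then show ?thesis
    by (simp add: norm_eq_sqrt_inner real_sqrt_mult)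
qed

lemma bounded_linear_scaleC: "bounded_linear (\<lambda>x :: 'a::complex_inner. c *\<^sub>C x)"
  by (rule bounded_linear_intro[where K = "cmod c"])
    (simp_all add: scaleC_add_right scaleR_scaleC scaleC_scaleC norm_scaleC mult.commute)

lift_definition blinfun_scaleC ::
    "complex \<Rightarrow> ('a::real_normed_vector \<Rightarrow>\<^sub>L 'b::complex_inner) \<Rightarrow> 'a \<Rightarrow>\<^sub>L 'b"
  is "\<lambda>c T x. c *\<^sub>C T x"
  by (rule bounded_linear_compose[OF bounded_linear_scaleC])

(* Elements of the type of blinfuns are only real-linear; the space of bounded operators between
   complex Hilbert spaces is the following subset. *)

definition bounded_ops :: "('a::chilbert_space \<Rightarrow>\<^sub>L 'b::chilbert_space) set"
  where "bounded_ops = {T :: 'a \<Rightarrow>\<^sub>L 'b. \<forall>c x. T (c *\<^sub>C x) = c *\<^sub>C T x}"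

definition op_subspace :: "('a::chilbert_space \<Rightarrow>\<^sub>L 'b::chilbert_space) set \<Rightarrow> bool"
  where "op_subspace M \<longleftrightarrow>
    M \<subseteq> bounded_ops \<and> 0 \<in> M \<and> (\<forall>S\<in>M. \<forall>T\<in>M. S + T \<in> M) \<and> (\<forall>c. \<forall>T\<in>M. blinfun_scaleC c T \<in> M)"

definition projections :: "('a::chilbert_space \<Rightarrow>\<^sub>L 'a) set"
  where "projections =
    {P \<in> bounded_ops. P o\<^sub>L P = P \<and> (\<forall>x y. cinner (P x) y = cinner x (P y))}"

definition proj_le :: "('a::chilbert_space \<Rightarrow>\<^sub>L 'a) \<Rightarrow> ('a \<Rightarrow>\<^sub>L 'a) \<Rightarrow> bool" (infix "\<sqsubseteq>" 50)
  where "P \<sqsubseteq> Q \<longleftrightarrow> range (blinfun_apply P) \<subseteq> range (blinfun_apply Q)"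

definition perp :: "('a::chilbert_space \<Rightarrow>\<^sub>L 'a) \<Rightarrow> ('a \<Rightarrow>\<^sub>L 'a)"
  where "perp P = id_blinfun - P"

definition Lat :: "('a::chilbert_space \<Rightarrow>\<^sub>L 'a) set \<Rightarrow> ('a \<Rightarrow>\<^sub>L 'a) set"
  where "Lat U = {P \<in> projections. \<forall>T\<in>U. perp P o\<^sub>L T o\<^sub>L P = 0}"

definition Lat_perp :: "('a::chilbert_space \<Rightarrow>\<^sub>L 'a) set \<Rightarrow> ('a \<Rightarrow>\<^sub>L 'a) set"
  where "Lat_perp U = perp ` Lat U"

definition alg_A :: "('a::chilbert_space \<Rightarrow>\<^sub>L 'b::chilbert_space) set \<Rightarrow> ('a \<Rightarrow>\<^sub>L 'a) set"
  where "alg_A M = {A \<in> bounded_ops. \<forall>T\<in>M. T o\<^sub>L A \<in> M}"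

definition alg_B :: "('a::chilbert_space \<Rightarrow>\<^sub>L 'b::chilbert_space) set \<Rightarrow> ('b \<Rightarrow>\<^sub>L 'b) set"
  where "alg_B M = {B \<in> bounded_ops. \<forall>T\<in>M. B o\<^sub>L T \<in> M}"

definition BIL ::
    "('a::chilbert_space \<Rightarrow>\<^sub>L 'b::chilbert_space) set \<Rightarrow> (('a \<Rightarrow>\<^sub>L 'a) \<times> ('b \<Rightarrow>\<^sub>L 'b)) set"
  where "BIL M = {(P, Q) \<in> projections \<times> projections. \<forall>T\<in>M. Q o\<^sub>L T o\<^sub>L P = 0}"

definition Bil ::
    "('a::chilbert_space \<Rightarrow>\<^sub>L 'b::chilbert_space) set \<Rightarrow> (('a \<Rightarrow>\<^sub>L 'a) \<times> ('b \<Rightarrow>\<^sub>L 'b)) set"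
  where "Bil M = BIL M \<inter> (Lat (alg_A M) \<times> Lat_perp (alg_B M))"

definition Op ::
    "(('a::chilbert_space \<Rightarrow>\<^sub>L 'a) \<times> ('b::chilbert_space \<Rightarrow>\<^sub>L 'b)) set \<Rightarrow> ('a \<Rightarrow>\<^sub>L 'b) set"
  where "Op F = {T \<in> bounded_ops. \<forall>(P, Q)\<in>F. Q o\<^sub>L T o\<^sub>L P = 0}"

definition reflexive_space :: "('a::chilbert_space \<Rightarrow>\<^sub>L 'b::chilbert_space) set \<Rightarrow> bool"
  where "reflexive_space M \<longleftrightarrow> Op (BIL M) = M"

end

theory Submission
  imports Defs
begin

text \<open>
  Write \<open>H\<^sub>1\<close> and \<open>H\<^sub>2\<close> for the two Hilbert spaces. The relation \<open>Q T P = 0\<close> for all \<open>T \<in> M\<close>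
  between projections \<open>P\<close> and \<open>Q\<close> is a polarity. For fixed \<open>Q\<close> there is a largest \<open>P\<close> related
  to it, the projection onto \<open>{x. \<forall>T\<in>M. Q T x = 0}\<close>; for fixed \<open>P\<close> there is a largest \<open>Q\<close>, the
  projection onto the orthogonal complement of the closed span of \<open>M P H\<^sub>1\<close>. The first range is
  invariant under every \<open>A\<close> with \<open>M A \<subseteq> M\<close>, and the closed span is invariant under every \<open>B\<close>
  with \<open>B M \<subseteq> M\<close>. So both maximal choices automatically have the invariance that \<open>Bil M\<close> demands
  (lemmas \<open>largest_left_partner\<close> and \<open>largest_right_partner\<close>).

  Two applications of the polarity therefore place every pair of \<open>BIL M\<close> below a pair of
  \<open>Bil M\<close>. As \<open>Q' T P' = 0\<close> implies \<open>Q T P = 0\<close> when \<open>P \<sqsubseteq> P'\<close> and \<open>Q \<sqsubseteq> Q'\<close>, the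
  operators annihilated by the small set of pairs are those annihilated by the large one:
  \<open>Op (Bil M) = Op (BIL M)\<close>.

  If \<open>M\<close> is reflexive, the identity serves as \<open>\<Psi>\<close>, and the two maximal choices serve as \<open>\<psi>1\<close>
  and \<open>\<psi>2\<close>: their pairs lie in \<open>BIL M\<close>, and they dominate all of \<open>Bil M\<close>. Conversely, if \<open>M\<close> is
  described by the pairs coming from any of the maps, then these pairs lie in \<open>BIL M\<close> because
  they annihilate \<open>M\<close>, so \<open>M\<close> is \<open>Op\<close> of a subset of \<open>BIL M\<close> and hence contains \<open>Op (BIL M)\<close>.
\<close>

section \<open>Orthogonal projections onto closed subspaces\<close>

text \<open>
  The near-minimizers of the distance from \<open>x\<close> form a nested sequence of closed sets. Their
  diameters shrink to zero by the parallelogram law, because the midpoint of two near-minimizers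
  lies in \<open>S\<close>; so completeness gives a minimizer.
\<close>

lemma nearest_point_exists:
  fixes S :: "'a::{real_inner,complete_space} set"
  assumes "closed S" "convex S" "S \<noteq> {}"
  obtains a where "a \<in> S" "\<And>s. s \<in> S \<Longrightarrow> (norm (x - a))\<^sup>2 \<le> (norm (x - s))\<^sup>2"
proof -
  let ?f = "\<lambda>s. (norm (x - s))\<^sup>2"
  define d where "d = (INF s\<in>S. ?f s)"
  have bdd: "bdd_below (?f ` S)"
    by (rule bdd_belowI[of _ 0]) auto
  have d_le: "d \<le> ?f s" if "s \<in> S" for s
    unfolding d_def by (rule cINF_lower[OF bdd that])
  define C where "C n = {s \<in> S. ?f s \<le> d + 1 / real (Suc n)}" for n
  have "closed (C n)" for n
  proof -
    have "C n = S \<inter> {s. ?f s \<le> d + 1 / real (Suc n)}"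
      unfolding C_def by auto
    moreover have "closed {s. ?f s \<le> d + 1 / real (Suc n)}"
      by (intro closed_Collect_le continuous_intros)
    ultimately show ?thesis
      using assms(1) by (simp add: closed_Int)
  qed
  moreover have "C n \<noteq> {}" for n
  proof -
    have "(INF s\<in>S. ?f s) < d + 1 / real (Suc n)"
      unfolding d_def by simp
    then obtain s where "s \<in> S" "?f s < d + 1 / real (Suc n)"
      using cINF_less_iff[OF assms(3) bdd] by blast
    then show ?thesis
      unfolding C_def by force
  qed
  moreover have "C n \<subseteq> C m" if "m \<le> n" for m n
  proof -
    have "1 / real (Suc n) \<le> 1 / real (Suc m)"
      using that by (simp add: frac_le)
    then show ?thesis
      unfolding C_def by force
  qed
  moreover have "\<exists>n. \<forall>s\<in>C n. \<forall>t\<in>C n. dist s t < e" if "e > 0" for e :: real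
  proof -
    have "0 < e\<^sup>2 / 4"
      using that by simp
    then obtain n where n: "1 / real (Suc n) < e\<^sup>2 / 4"
      by (rule nat_approx_posE)
    have "dist s t < e" if st: "s \<in> C n" "t \<in> C n" for s t
    proof -
      let ?m = "(1 / 2) *\<^sub>R s + (1 / 2) *\<^sub>R t"
      have "?m \<in> S"
        using st assms(2) unfolding C_def by (intro convexD) auto
      then have "d \<le> ?f ?m"
        by (rule d_le)
      moreover have "(norm (s - t))\<^sup>2 = 2 * ?f s + 2 * ?f t - 4 * ?f ?m"
        by (simp add: power2_norm_eq_inner inner_simps inner_commute algebra_simps)
      ultimately have "(norm (s - t))\<^sup>2 \<le> 4 * (1 / real (Suc n))"
        using st unfolding C_def by simp
      then have "(norm (s - t))\<^sup>2 < e\<^sup>2"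
        using n by simp
      then show ?thesis
        using \<open>e > 0\<close> by (simp add: dist_norm power2_less_imp_less)
    qed
    then show ?thesis
      by blast
  qed
  ultimately obtain a where a: "\<And>n. a \<in> C n"
    using decreasing_closed_nest[of C] by metis
  have "?f a \<le> d"
  proof (rule field_le_epsilon)
    fix e :: real
    assume "e > 0"
    then obtain n where "1 / real (Suc n) < e"
      using nat_approx_posE by blast
    then show "?f a \<le> d + e"
      using a[of n] unfolding C_def by simp
  qed
  moreover have "a \<in> S"
    using a[of 0] unfolding C_def by simp
  ultimately show thesis
    using that d_le order_trans by blast
qed

lemma orthogonal_decomposition_exists:
  fixes S :: "'a::{real_inner,complete_space} set"
  assumes "closed S" "subspace S"
  obtains a where "a \<in> S" "\<And>v. v \<in> S \<Longrightarrow> inner (x - a) v = 0"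
proof -
  obtain a where a: "a \<in> S" "\<And>s. s \<in> S \<Longrightarrow> (norm (x - a))\<^sup>2 \<le> (norm (x - s))\<^sup>2"
    using nearest_point_exists[of S x] assms subspace_imp_convex subspace_0 by blast
  have "inner (x - a) v = 0" if v: "v \<in> S" for v
  proof (cases "v = 0")
    case False
    \<comment> \<open>Moving \<open>a\<close> by the component of \<open>x - a\<close> along \<open>v\<close> would bring it strictly closer.\<close>
    define t where "t = inner (x - a) v / inner v v"
    have vv: "inner v v > 0"
      using False by simp
    have "a + t *\<^sub>R v \<in> S"
      using a(1) v assms(2) by (simp add: subspace_add subspace_scale)
    then have "(norm (x - a))\<^sup>2 \<le> (norm (x - (a + t *\<^sub>R v)))\<^sup>2"
      by (rule a(2))
    also have "\<dots> = (norm ((x - a) - t *\<^sub>R v))\<^sup>2"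
      by (simp add: algebra_simps)
    also have "\<dots> = (norm (x - a))\<^sup>2 - 2 * t * inner (x - a) v + t * t * inner v v"
      unfolding power2_norm_eq_inner inner_diff_left[of "x - a" "t *\<^sub>R v"]
        inner_diff_right[of _ "x - a" "t *\<^sub>R v"]
      by (simp add: algebra_simps inner_commute)
    also have "t * t * inner v v = t * inner (x - a) v"
      using vv by (simp add: t_def)
    finally have "t * inner (x - a) v \<le> 0"
      by simp
    then have "(inner (x - a) v)\<^sup>2 \<le> 0"
      using vv by (simp add: t_def power2_eq_square divide_le_0_iff)
    then show ?thesis
      by simp
  qed simp
  then show thesis
    using that a(1) by blast
qed

definition closed_csubspace :: "'a::chilbert_space set \<Rightarrow> bool"
  where "closed_csubspace S \<longleftrightarrow> closed S \<and> subspace S \<and> (\<forall>c. \<forall>x\<in>S. c *\<^sub>C x \<in> S)"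

lemma scaleC_zero_right [simp]: "c *\<^sub>C (0 :: 'a::complex_inner) = 0"
  using scaleC_add_right[of c 0 "0 :: 'a"] by simp

lemma scaleC_diff_right: "c *\<^sub>C (x - y) = c *\<^sub>C x - c *\<^sub>C (y :: 'a::complex_inner)"
  using scaleC_add_right[of c "x - y" y] by simp

lemma cinner_scaleC_right: "cinner x (c *\<^sub>C y) = cnj c * cinner x y"
  by (metis cinner_commute cinner_scaleC_left complex_cnj_mult)

lemma cinner_diff_left: "cinner (x - y) z = cinner x z - cinner y z"
  using cinner_add_left[of "x - y" y z] by simp

lemma cinner_diff_right: "cinner z (x - y) = cinner z x - cinner z y"
  by (metis cinner_commute cinner_diff_left complex_cnj_diff)

lemma cinner_zero_left [simp]: "cinner 0 x = 0"
  using cinner_diff_left[of x x x] by simp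

lemma cinner_zero_right [simp]: "cinner x 0 = 0"
  using cinner_diff_right[of x x x] by simp

lemma cinner_eq_zero_iff: "cinner x x = 0 \<longleftrightarrow> x = 0"
  using inner_eq_Re_cinner[of x x] by auto

text \<open>The imaginary part of \<open>cinner x v\<close> is the real inner product of \<open>x\<close> with \<open>\<i> v\<close>.\<close>

lemma cinner_zero_if_inner_zero:
  assumes "closed_csubspace S" "\<And>v. v \<in> S \<Longrightarrow> inner x v = 0" "v \<in> S"
  shows "cinner x v = 0"
proof -
  have "inner x (\<i> *\<^sub>C v) = 0"
    using assms unfolding closed_csubspace_def by blast
  then have "Im (cinner x v) = 0"
    by (simp add: inner_eq_Re_cinner cinner_scaleC_right)
  moreover have "Re (cinner x v) = 0"
    using assms(2)[OF assms(3)] by (simp add: inner_eq_Re_cinner)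
  ultimately show ?thesis
    by (simp add: complex_eq_iff)
qed

theorem projection_onto_exists:
  assumes S: "closed_csubspace (S :: 'a::chilbert_space set)"
  obtains P where "P \<in> projections" "range (blinfun_apply P) = S"
proof -
  have sub: "subspace S" and sc: "\<And>c x. x \<in> S \<Longrightarrow> c *\<^sub>C x \<in> S"
    using S unfolding closed_csubspace_def by auto
  have "\<forall>x. \<exists>a. a \<in> S \<and> (\<forall>v\<in>S. inner (x - a) v = 0)"
    using orthogonal_decomposition_exists[of S] S unfolding closed_csubspace_def by metis
  then obtain p where p: "\<And>x. p x \<in> S" "\<And>x v. v \<in> S \<Longrightarrow> inner (x - p x) v = 0"
    by metis
  have pc: "cinner (x - p x) v = 0" if "v \<in> S" for x v
    using cinner_zero_if_inner_zero[OF S, of "x - p x"] p(2) that by blast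
  have uniq: "p x = a" if a: "a \<in> S" "\<And>v. v \<in> S \<Longrightarrow> cinner (x - a) v = 0" for x a
  proof -
    have d: "p x - a \<in> S"
      using p(1) a(1) sub by (simp add: subspace_diff)
    have "p x - a = (x - a) - (x - p x)"
      by simp
    then have "cinner (p x - a) (p x - a) = 0"
      using a(2)[OF d] pc[OF d] by (metis cinner_diff_left diff_zero)
    then show ?thesis
      by (simp add: cinner_eq_zero_iff)
  qed
  have padd: "p (x + y) = p x + p y" for x y
  proof (rule uniq)
    fix v assume v: "v \<in> S"
    have "x + y - (p x + p y) = (x - p x) + (y - p y)"
      by simp
    then show "cinner (x + y - (p x + p y)) v = 0"
      using pc[OF v] by (simp only: cinner_add_left) simp
  qed (use p(1) sub subspace_add in blast)
  have pscale: "p (c *\<^sub>C x) = c *\<^sub>C p x" for c x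
  proof (rule uniq)
    fix v assume v: "v \<in> S"
    show "cinner (c *\<^sub>C x - c *\<^sub>C p x) v = 0"
      using pc[OF v] by (simp add: scaleC_diff_right[symmetric] cinner_scaleC_left)
  qed (use p(1) sc in blast)
  have pnorm: "norm (p x) \<le> norm x" for x
  proof -
    have "inner x x = inner (p x) (p x) + inner (x - p x) (x - p x)"
      using p(2)[OF p(1), of x x] by (simp add: inner_diff_left inner_diff_right inner_commute)
    then show ?thesis
      by (simp add: norm_le)
  qed
  have bl: "bounded_linear p"
    by (rule bounded_linear_intro[where K = 1]) (auto simp: padd pscale scaleR_scaleC pnorm)
  define P where "P = Blinfun p"
  have P: "blinfun_apply P = p"
    unfolding P_def by (rule bounded_linear_Blinfun_apply[OF bl])
  have fix_S: "p x = x" if "x \<in> S" for x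
    using uniq[OF that] cinner_diff_left[of x x] by simp
  have sa: "cinner (p x) y = cinner x (p y)" for x y
  proof -
    have "cinner (p x) (y - p y) = 0"
      using pc[OF p(1), of y x] by (metis cinner_commute complex_cnj_zero)
    then show ?thesis
      using pc[OF p(1), of x y] by (simp add: cinner_diff_left cinner_diff_right)
  qed
  have "P \<in> projections"
    unfolding projections_def bounded_ops_def
    using pscale sa p(1) by (auto simp: P fix_S intro: blinfun_eqI)
  moreover have "range (blinfun_apply P) = S"
    using p(1) fix_S unfolding P by (metis image_subsetI rangeI subsetI subset_antisym)
  ultimately show thesis
    by (rule that)
qed

section \<open>Projections and their ranges\<close>

lemma projection_in_bounded_ops: "P \<in> projections \<Longrightarrow> P \<in> bounded_ops"
  by (simp add: projections_def)

lemma projection_idem: "P \<in> projections \<Longrightarrow> P (P x) = P x"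
proof -
  assume "P \<in> projections"
  then have "P o\<^sub>L P = P"
    by (simp add: projections_def)
  then have "(P o\<^sub>L P) x = P x"
    by simp
  then show ?thesis
    by simp
qed

lemma proj_le_iff:
  assumes "P \<in> projections" "P' \<in> projections"
  shows "P \<sqsubseteq> P' \<longleftrightarrow> (\<forall>x. P' (P x) = P x)"
proof
  assume "P \<sqsubseteq> P'"
  then have "P x \<in> range (blinfun_apply P')" for x
    unfolding proj_le_def by blast
  then show "\<forall>x. P' (P x) = P x"
    using projection_idem[OF assms(2)] by (metis rangeE)
next
  assume "\<forall>x. P' (P x) = P x"
  then show "P \<sqsubseteq> P'"
    unfolding proj_le_def by (metis image_subsetI rangeI)
qed

lemma proj_le_refl: "P \<sqsubseteq> P"
  by (simp add: proj_le_def)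

lemma perp_apply: "perp P x = x - P x"
  by (simp add: perp_def blinfun.diff_left)

lemma perp_in_projections:
  assumes "P \<in> projections"
  shows "perp P \<in> projections"
proof -
  have "perp P \<in> bounded_ops"
    using assms by (auto simp: projections_def bounded_ops_def perp_apply scaleC_diff_right)
  moreover have "perp P o\<^sub>L perp P = perp P"
    by (rule blinfun_eqI) (simp add: perp_apply blinfun.diff_right projection_idem[OF assms])
  moreover have "cinner (perp P x) y = cinner x (perp P y)" for x y
    using assms by (simp add: projections_def perp_apply cinner_diff_left cinner_diff_right)
  ultimately show ?thesis
    by (simp add: projections_def)
qed

text \<open>Taking adjoints turns \<open>Q E = 0\<close> into \<open>E Q = 0\<close>, which is what \<open>Q \<sqsubseteq> perp E\<close> says.\<close>

lemma proj_le_perpI: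
  assumes Q: "Q \<in> projections" and E: "E \<in> projections" and QE: "\<And>x. Q (E x) = 0"
  shows "Q \<sqsubseteq> perp E"
proof -
  have "E (Q x) = 0" for x
  proof -
    have "cinner (E (Q x)) (E (Q x)) = cinner x (Q (E (E (Q x))))"
      using Q E by (simp add: projections_def)
    also have "\<dots> = 0"
      by (simp add: QE)
    finally show ?thesis
      by (simp add: cinner_eq_zero_iff)
  qed
  then show ?thesis
    by (simp add: proj_le_iff[OF Q perp_in_projections[OF E]] perp_apply)
qed

lemma compose3_eq_zero_iff:
  "Q o\<^sub>L T o\<^sub>L P = 0 \<longleftrightarrow> (\<forall>x. blinfun_apply Q (T (P x)) = 0)"
  by (auto intro!: blinfun_eqI) (metis blinfun_apply_blinfun_compose zero_blinfun.rep_eq)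

lemma compose3_zero_mono:
  assumes "P \<in> projections" "P' \<in> projections" "Q \<in> projections" "Q' \<in> projections"
    and "P \<sqsubseteq> P'" "Q \<sqsubseteq> Q'" "Q' o\<^sub>L T o\<^sub>L P' = 0"
  shows "Q o\<^sub>L T o\<^sub>L P = 0"
proof -
  have "Q (T (P x)) = 0" for x
  proof -
    have "Q' (T (P x)) = 0"
      using assms(1,2,5,7) by (metis compose3_eq_zero_iff proj_le_iff)
    \<comment> \<open>\<open>Q = Q Q'\<close> is the adjoint of \<open>Q = Q' Q\<close>.\<close>
    have "cinner (Q (T (P x))) (Q (T (P x))) = cinner (Q' (T (P x))) (Q (T (P x)))"
    proof -
      have "cinner (Q y) (Q y) = cinner y (Q y)" "cinner (Q' y) (Q y) = cinner y (Q' (Q y))" for y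
        using assms(3,4) projection_idem[OF assms(3)] by (simp_all add: projections_def)
      moreover have "Q' (Q y) = Q y" for y
        using assms(6) proj_le_iff[OF assms(3,4)] by simp
      ultimately show ?thesis
        by simp
    qed
    also have "\<dots> = 0"
      using \<open>Q' (T (P x)) = 0\<close> by simp
    finally show ?thesis
      by (simp add: cinner_eq_zero_iff)
  qed
  then show ?thesis
    by (simp add: compose3_eq_zero_iff)
qed

section \<open>The polarity between projections induced by an operator space\<close>

lemma closed_csubspace_vimage:
  assumes "T \<in> bounded_ops" "closed_csubspace V"
  shows "closed_csubspace (blinfun_apply T -` V)"
proof -
  have "closed (blinfun_apply T -` V)"
    using assms(2) unfolding closed_csubspace_def
    by (intro closed_vimage) (auto intro: continuous_intros)
  then show ?thesis
    using assms unfolding closed_csubspace_def bounded_ops_def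
    by (auto simp: subspace_def blinfun.add_right blinfun.scaleR_right blinfun.zero_right)
qed

lemma closed_csubspace_Inter:
  assumes "\<And>V. V \<in> \<V> \<Longrightarrow> closed_csubspace V"
  shows "closed_csubspace (\<Inter>\<V>)"
  using assms unfolding closed_csubspace_def by (auto intro!: closed_Inter subspace_Inter)

lemma closed_csubspace_kernel:
  assumes "T \<in> bounded_ops"
  shows "closed_csubspace {x. blinfun_apply T x = 0}"
proof -
  have "closed_csubspace {0 :: 'b}"
    by (simp add: closed_csubspace_def)
  from closed_csubspace_vimage[OF assms this] show ?thesis
    by (simp add: vimage_def)
qed

definition closed_cspan :: "'a::chilbert_space set \<Rightarrow> 'a set"
  where "closed_cspan G = \<Inter> {V. closed_csubspace V \<and> G \<subseteq> V}"

lemma closed_csubspace_closed_cspan: "closed_csubspace (closed_cspan G)"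
  unfolding closed_cspan_def by (rule closed_csubspace_Inter) auto

lemma closed_cspan_superset: "G \<subseteq> closed_cspan G"
  unfolding closed_cspan_def by auto

lemma closed_cspan_minimal: "closed_csubspace V \<Longrightarrow> G \<subseteq> V \<Longrightarrow> closed_cspan G \<subseteq> V"
  unfolding closed_cspan_def by auto

lemma Lat_iff:
  "P \<in> Lat U \<longleftrightarrow> P \<in> projections \<and> (\<forall>T\<in>U. \<forall>x\<in>range (blinfun_apply P). T x \<in> range (blinfun_apply P))"
  (is "_ \<longleftrightarrow> ?R")
proof -
  have "perp P o\<^sub>L T o\<^sub>L P = 0 \<longleftrightarrow> (\<forall>x\<in>range (blinfun_apply P). T x \<in> range (blinfun_apply P))"
    if "P \<in> projections" for T
    using projection_idem[OF that]
    by (auto simp: compose3_eq_zero_iff perp_apply) (metis rangeE rangeI)+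
  then show ?thesis
    unfolding Lat_def by auto
qed

lemma Lat_projections: "P \<in> Lat U \<Longrightarrow> P \<in> projections"
  by (simp add: Lat_def)

lemma Lat_perp_projections: "Q \<in> Lat_perp U \<Longrightarrow> Q \<in> projections"
  unfolding Lat_perp_def using Lat_projections perp_in_projections by blast

lemma BIL_iff:
  "(P, Q) \<in> BIL M \<longleftrightarrow> P \<in> projections \<and> Q \<in> projections \<and> (\<forall>T\<in>M. Q o\<^sub>L T o\<^sub>L P = 0)"
  by (simp add: BIL_def)

text \<open>
  The projection onto \<open>{x. \<forall>T\<in>M. Q T x = 0}\<close>. If \<open>x\<close> is in this range and \<open>M A \<subseteq> M\<close>, then
  \<open>Q T A x = 0\<close> since \<open>T A\<close> is again in \<open>M\<close>; hence the invariance.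
\<close>

lemma largest_left_partner:
  fixes M :: "('a::chilbert_space \<Rightarrow>\<^sub>L 'b::chilbert_space) set"
  assumes M: "M \<subseteq> bounded_ops" and Q: "Q \<in> projections"
  obtains P' where "P' \<in> Lat (alg_A M)" "(P', Q) \<in> BIL M" "\<And>P. (P, Q) \<in> BIL M \<Longrightarrow> P \<sqsubseteq> P'"
proof -
  let ?S = "{x. \<forall>T\<in>M. Q (T x) = 0}"
  have "?S = \<Inter> ((\<lambda>T. blinfun_apply T -` {y. Q y = 0}) ` M)"
    by auto
  moreover have "closed_csubspace \<dots>"
    using M closed_csubspace_vimage closed_csubspace_kernel[OF projection_in_bounded_ops[OF Q]]
    by (intro closed_csubspace_Inter) blast
  ultimately have "closed_csubspace ?S"
    by simp
  then obtain P' where P': "P' \<in> projections" "range (blinfun_apply P') = ?S"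
    by (rule projection_onto_exists)
  have "P' \<in> Lat (alg_A M)"
    unfolding Lat_iff P'(2) alg_A_def using P'(1) by auto (metis blinfun_apply_blinfun_compose)
  moreover have "(P', Q) \<in> BIL M"
    using P' Q by (auto simp: BIL_iff compose3_eq_zero_iff)
  moreover have "P \<sqsubseteq> P'" if "(P, Q) \<in> BIL M" for P
    using that unfolding proj_le_def P'(2) by (auto simp: BIL_iff compose3_eq_zero_iff)
  ultimately show thesis
    by (rule that)
qed

text \<open>
  The complement of the projection onto the closed span of \<open>M P H\<^sub>1\<close>. If \<open>B M \<subseteq> M\<close>, the
  preimage under \<open>B\<close> of a closed subspace containing \<open>M P H\<^sub>1\<close> is another such subspace;
  hence the invariance of the span. A \<open>Q\<close> related to \<open>P\<close> vanishes on \<open>M P H\<^sub>1\<close>, so its kernel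
  contains the span; hence the maximality.
\<close>

lemma largest_right_partner:
  fixes M :: "('a::chilbert_space \<Rightarrow>\<^sub>L 'b::chilbert_space) set"
  assumes P: "P \<in> projections"
  obtains Q' where "Q' \<in> Lat_perp (alg_B M)" "(P, Q') \<in> BIL M" "\<And>Q. (P, Q) \<in> BIL M \<Longrightarrow> Q \<sqsubseteq> Q'"
proof -
  let ?G = "\<Union>T\<in>M. range (\<lambda>x. blinfun_apply T (P x))"
  obtain E where E: "E \<in> projections" "range (blinfun_apply E) = closed_cspan ?G"
    using projection_onto_exists[OF closed_csubspace_closed_cspan] by blast
  have G_E: "E (T (P x)) = T (P x)" if "T \<in> M" for T x
  proof -
    have "T (P x) \<in> range (blinfun_apply E)"
      using closed_cspan_superset[of ?G] that unfolding E(2) by blast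
    then show ?thesis
      using projection_idem[OF E(1)] by auto
  qed
  have "B y \<in> closed_cspan ?G" if B: "B \<in> alg_B M" and y: "y \<in> closed_cspan ?G" for B y
  proof -
    have "blinfun_apply B -` closed_cspan ?G \<supseteq> ?G"
    proof
      fix g assume "g \<in> ?G"
      then obtain T x where "T \<in> M" "g = T (P x)"
        by blast
      then have "B o\<^sub>L T \<in> M" "B g = (B o\<^sub>L T) (P x)"
        using B by (auto simp: alg_B_def)
      then show "g \<in> blinfun_apply B -` closed_cspan ?G"
        using closed_cspan_superset[of ?G] by (simp only: vimage_eq) blast
    qed
    moreover have "closed_csubspace (blinfun_apply B -` closed_cspan ?G)"
      using B by (intro closed_csubspace_vimage closed_csubspace_closed_cspan) (simp add: alg_B_def)
    ultimately show ?thesis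
      using closed_cspan_minimal y by blast
  qed
  then have "E \<in> Lat (alg_B M)"
    unfolding Lat_iff E(2) using E(1) by blast
  then have "perp E \<in> Lat_perp (alg_B M)"
    by (simp add: Lat_perp_def)
  moreover have "(P, perp E) \<in> BIL M"
    using P perp_in_projections[OF E(1)] G_E
    by (simp add: BIL_iff compose3_eq_zero_iff perp_apply)
  moreover have "Q \<sqsubseteq> perp E" if Q: "(P, Q) \<in> BIL M" for Q
  proof (rule proj_le_perpI)
    show "Q \<in> projections" "E \<in> projections"
      using Q E(1) by (auto simp: BIL_iff)
    then have "closed_csubspace {y. Q y = 0}"
      by (intro closed_csubspace_kernel projection_in_bounded_ops)
    moreover have "?G \<subseteq> {y. Q y = 0}"
      using Q by (auto simp: BIL_iff compose3_eq_zero_iff)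
    ultimately have "closed_cspan ?G \<subseteq> {y. Q y = 0}"
      by (rule closed_cspan_minimal)
    then show "Q (E x) = 0" for x
      using E(2) by blast
  qed
  ultimately show thesis
    by (rule that)
qed

section \<open>Reflexivity\<close>

lemma BIL_dominated_by_Bil:
  assumes M: "M \<subseteq> bounded_ops" and PQ: "(P, Q) \<in> BIL M"
  obtains P' Q' where "(P', Q') \<in> Bil M" "P \<sqsubseteq> P'" "Q \<sqsubseteq> Q'"
proof -
  have "Q \<in> projections"
    using PQ by (simp add: BIL_iff)
  from largest_left_partner[OF M this] obtain P' where
    P': "P' \<in> Lat (alg_A M)" "(P', Q) \<in> BIL M" "P \<sqsubseteq> P'"
    using PQ by metis
  from largest_right_partner[OF Lat_projections[OF P'(1)]] obtain Q' where
    "Q' \<in> Lat_perp (alg_B M)" "(P', Q') \<in> BIL M" "Q \<sqsubseteq> Q'"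
    using P'(2) by metis
  then show thesis
    using that P' by (auto simp: Bil_def)
qed

text \<open>The form in which domination is used: pairs above all of \<open>Bil M\<close> suffice to test membership.\<close>

lemma Op_BIL_if_dominating:
  assumes M: "M \<subseteq> bounded_ops" and T: "T \<in> bounded_ops"
    and dom: "\<And>P Q. (P, Q) \<in> Bil M \<Longrightarrow>
      \<exists>P'\<in>projections. \<exists>Q'\<in>projections. P \<sqsubseteq> P' \<and> Q \<sqsubseteq> Q' \<and> Q' o\<^sub>L T o\<^sub>L P' = 0"
  shows "T \<in> Op (BIL M)"
proof -
  have "Q o\<^sub>L T o\<^sub>L P = 0" if PQ: "(P, Q) \<in> BIL M" for P Q
  proof -
    obtain P1 Q1 where 1: "(P1, Q1) \<in> Bil M" "P \<sqsubseteq> P1" "Q \<sqsubseteq> Q1"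
      using BIL_dominated_by_Bil[OF M PQ] .
    then have "P1 \<in> projections" "Q1 \<in> projections"
      by (auto simp: Bil_def BIL_iff)
    moreover obtain P2 Q2 where "P2 \<in> projections" "Q2 \<in> projections" "P1 \<sqsubseteq> P2" "Q1 \<sqsubseteq> Q2"
      "Q2 o\<^sub>L T o\<^sub>L P2 = 0"
      using dom[OF 1(1)] by blast
    ultimately have "Q1 o\<^sub>L T o\<^sub>L P1 = 0"
      using compose3_zero_mono by blast
    then show ?thesis
      using PQ 1 \<open>P1 \<in> projections\<close> \<open>Q1 \<in> projections\<close> compose3_zero_mono
      unfolding BIL_iff by blast
  qed
  then show ?thesis
    using T by (auto simp: Op_def)
qed

lemma subset_Op_BIL: "M \<subseteq> bounded_ops \<Longrightarrow> M \<subseteq> Op (BIL M)"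
  by (auto simp: Op_def BIL_iff)

text \<open>
  The family \<open>F\<close> annihilates \<open>Op F\<close>, so it is contained in \<open>BIL (Op F)\<close>; and \<open>Op\<close> reverses
  inclusions.
\<close>

lemma reflexive_if_eq_Op:
  assumes "M = Op F" "F \<subseteq> projections \<times> projections"
  shows "reflexive_space M"
proof -
  have "M \<subseteq> bounded_ops"
    using assms(1) by (auto simp: Op_def)
  moreover have "F \<subseteq> BIL M"
    using assms by (auto simp: BIL_iff Op_def)
  then have "Op (BIL M) \<subseteq> M"
    using assms(1) by (auto simp: Op_def)
  ultimately show ?thesis
    using subset_Op_BIL unfolding reflexive_space_def by blast
qed

lemma reflexive_eq_Op_if_dominating:
  assumes M: "M \<subseteq> bounded_ops" "reflexive_space M" and F: "F \<subseteq> BIL M"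
    and dom: "\<And>P Q. (P, Q) \<in> Bil M \<Longrightarrow> \<exists>(P', Q')\<in>F. P \<sqsubseteq> P' \<and> Q \<sqsubseteq> Q'"
  shows "M = Op F"
proof
  show "M \<subseteq> Op F"
    using M(1) F by (auto simp: Op_def BIL_iff dest!: subsetD[OF F])
  show "Op F \<subseteq> M"
  proof
    fix T assume T: "T \<in> Op F"
    have "T \<in> Op (BIL M)"
    proof (rule Op_BIL_if_dominating[OF M(1)])
      show "T \<in> bounded_ops"
        using T by (simp add: Op_def)
      fix P Q assume "(P, Q) \<in> Bil M"
      then obtain P' Q' where "(P', Q') \<in> F" "P \<sqsubseteq> P'" "Q \<sqsubseteq> Q'"
        using dom by blast
      moreover from this have "P' \<in> projections" "Q' \<in> projections"
        using F by (auto simp: BIL_iff)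
      moreover from calculation(1) have "Q' o\<^sub>L T o\<^sub>L P' = 0"
        using T by (auto simp: Op_def)
      ultimately show "\<exists>P'\<in>projections. \<exists>Q'\<in>projections. P \<sqsubseteq> P' \<and> Q \<sqsubseteq> Q' \<and> Q' o\<^sub>L T o\<^sub>L P' = 0"
        by blast
    qed
    then show "T \<in> M"
      using M(2) by (simp add: reflexive_space_def)
  qed
qed

theorem theorem3p5:
  fixes M :: "('a::chilbert_space \<Rightarrow>\<^sub>L 'b::chilbert_space) set"
  assumes "op_subspace M"
  shows
    "(reflexive_space M \<longleftrightarrow>
      (\<exists>\<Psi>. \<Psi> \<in> Bil M \<rightarrow> Bil M \<and>
        (\<forall>(P, Q)\<in>Bil M. P \<sqsubseteq> fst (\<Psi> (P, Q)) \<and> Q \<sqsubseteq> snd (\<Psi> (P, Q))) \<and>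
        M = {T \<in> bounded_ops. \<forall>(P, Q)\<in>Bil M. snd (\<Psi> (P, Q)) o\<^sub>L T o\<^sub>L fst (\<Psi> (P, Q)) = 0}))
    \<and> (reflexive_space M \<longleftrightarrow>
      (\<exists>\<psi>1. \<psi>1 \<in> Lat_perp (alg_B M) \<rightarrow> Lat (alg_A M) \<and>
        (\<forall>(P, Q)\<in>Bil M. P \<sqsubseteq> \<psi>1 Q) \<and>
        M = {T \<in> bounded_ops. \<forall>Q\<in>Lat_perp (alg_B M). Q o\<^sub>L T o\<^sub>L \<psi>1 Q = 0}))
    \<and> (reflexive_space M \<longleftrightarrow>
      (\<exists>\<psi>2. \<psi>2 \<in> Lat (alg_A M) \<rightarrow> Lat_perp (alg_B M) \<and>
        (\<forall>(P, Q)\<in>Bil M. Q \<sqsubseteq> \<psi>2 P) \<and>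
        M = {T \<in> bounded_ops. \<forall>P\<in>Lat (alg_A M). \<psi>2 P o\<^sub>L T o\<^sub>L P = 0}))"
proof (intro conjI iffI)
  have M: "M \<subseteq> bounded_ops"
    using assms by (simp add: op_subspace_def)
  note projs = Lat_projections Lat_perp_projections
  {
    assume r: "reflexive_space M"
    have "M = Op (Bil M)"
      by (rule reflexive_eq_Op_if_dominating[OF M r]) (auto simp: Bil_def intro: proj_le_refl)
    then show "\<exists>\<Psi>. \<Psi> \<in> Bil M \<rightarrow> Bil M \<and>
        (\<forall>(P, Q)\<in>Bil M. P \<sqsubseteq> fst (\<Psi> (P, Q)) \<and> Q \<sqsubseteq> snd (\<Psi> (P, Q))) \<and>
        M = {T \<in> bounded_ops. \<forall>(P, Q)\<in>Bil M. snd (\<Psi> (P, Q)) o\<^sub>L T o\<^sub>L fst (\<Psi> (P, Q)) = 0}"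
      unfolding Op_def by (intro exI[of _ id] conjI) (simp_all add: proj_le_refl case_prod_beta)
  next
    assume r: "reflexive_space M"
    have "\<forall>Q\<in>Lat_perp (alg_B M). \<exists>P'\<in>Lat (alg_A M).
        (P', Q) \<in> BIL M \<and> (\<forall>P. (P, Q) \<in> BIL M \<longrightarrow> P \<sqsubseteq> P')"
      using largest_left_partner[OF M Lat_perp_projections] by metis
    then obtain \<psi> where \<psi>: "\<And>Q. Q \<in> Lat_perp (alg_B M) \<Longrightarrow>
        \<psi> Q \<in> Lat (alg_A M) \<and> (\<psi> Q, Q) \<in> BIL M \<and> (\<forall>P. (P, Q) \<in> BIL M \<longrightarrow> P \<sqsubseteq> \<psi> Q)"
      by metis
    have dom: "Q \<in> Lat_perp (alg_B M) \<and> P \<sqsubseteq> \<psi> Q" if "(P, Q) \<in> Bil M" for P Q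
      using that \<psi> by (auto simp: Bil_def)
    have "M = Op ((\<lambda>Q. (\<psi> Q, Q)) ` Lat_perp (alg_B M))"
      by (rule reflexive_eq_Op_if_dominating[OF M r]) (use \<psi> dom proj_le_refl in blast)+
    also have "\<dots> = {T \<in> bounded_ops. \<forall>Q\<in>Lat_perp (alg_B M). Q o\<^sub>L T o\<^sub>L \<psi> Q = 0}"
      by (simp add: Op_def)
    finally show "\<exists>\<psi>1. \<psi>1 \<in> Lat_perp (alg_B M) \<rightarrow> Lat (alg_A M) \<and>
        (\<forall>(P, Q)\<in>Bil M. P \<sqsubseteq> \<psi>1 Q) \<and>
        M = {T \<in> bounded_ops. \<forall>Q\<in>Lat_perp (alg_B M). Q o\<^sub>L T o\<^sub>L \<psi>1 Q = 0}"
      using \<psi> dom by (intro exI[of _ \<psi>] conjI) blast+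
  next
    assume r: "reflexive_space M"
    have "\<forall>P\<in>Lat (alg_A M). \<exists>Q'\<in>Lat_perp (alg_B M).
        (P, Q') \<in> BIL M \<and> (\<forall>Q. (P, Q) \<in> BIL M \<longrightarrow> Q \<sqsubseteq> Q')"
      using largest_right_partner[OF Lat_projections] by metis
    then obtain \<psi> where \<psi>: "\<And>P. P \<in> Lat (alg_A M) \<Longrightarrow>
        \<psi> P \<in> Lat_perp (alg_B M) \<and> (P, \<psi> P) \<in> BIL M \<and> (\<forall>Q. (P, Q) \<in> BIL M \<longrightarrow> Q \<sqsubseteq> \<psi> P)"
      by metis
    have dom: "P \<in> Lat (alg_A M) \<and> Q \<sqsubseteq> \<psi> P" if "(P, Q) \<in> Bil M" for P Q
      using that \<psi> by (auto simp: Bil_def)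
    have "M = Op ((\<lambda>P. (P, \<psi> P)) ` Lat (alg_A M))"
      by (rule reflexive_eq_Op_if_dominating[OF M r]) (use \<psi> dom proj_le_refl in blast)+
    also have "\<dots> = {T \<in> bounded_ops. \<forall>P\<in>Lat (alg_A M). \<psi> P o\<^sub>L T o\<^sub>L P = 0}"
      by (simp add: Op_def)
    finally show "\<exists>\<psi>2. \<psi>2 \<in> Lat (alg_A M) \<rightarrow> Lat_perp (alg_B M) \<and>
        (\<forall>(P, Q)\<in>Bil M. Q \<sqsubseteq> \<psi>2 P) \<and>
        M = {T \<in> bounded_ops. \<forall>P\<in>Lat (alg_A M). \<psi>2 P o\<^sub>L T o\<^sub>L P = 0}"
      using \<psi> dom by (intro exI[of _ \<psi>] conjI) blast+
  }
  {
    assume "\<exists>\<Psi>. \<Psi> \<in> Bil M \<rightarrow> Bil M \<and>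
        (\<forall>(P, Q)\<in>Bil M. P \<sqsubseteq> fst (\<Psi> (P, Q)) \<and> Q \<sqsubseteq> snd (\<Psi> (P, Q))) \<and>
        M = {T \<in> bounded_ops. \<forall>(P, Q)\<in>Bil M. snd (\<Psi> (P, Q)) o\<^sub>L T o\<^sub>L fst (\<Psi> (P, Q)) = 0}"
    then obtain \<Psi> where \<Psi>: "\<Psi> \<in> Bil M \<rightarrow> Bil M"
      "M = {T \<in> bounded_ops. \<forall>(P, Q)\<in>Bil M. snd (\<Psi> (P, Q)) o\<^sub>L T o\<^sub>L fst (\<Psi> (P, Q)) = 0}"
      by blast
    show "reflexive_space M"
    proof (rule reflexive_if_eq_Op)
      show "M = Op (\<Psi> ` Bil M)"
        by (rule trans[OF \<Psi>(2)]) (simp add: Op_def case_prod_beta)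
      have "\<Psi> ` Bil M \<subseteq> Bil M"
        using \<Psi>(1) by blast
      also have "\<dots> \<subseteq> projections \<times> projections"
        by (auto simp: Bil_def BIL_iff)
      finally show "\<Psi> ` Bil M \<subseteq> projections \<times> projections" .
    qed
  next
    assume "\<exists>\<psi>1. \<psi>1 \<in> Lat_perp (alg_B M) \<rightarrow> Lat (alg_A M) \<and>
        (\<forall>(P, Q)\<in>Bil M. P \<sqsubseteq> \<psi>1 Q) \<and>
        M = {T \<in> bounded_ops. \<forall>Q\<in>Lat_perp (alg_B M). Q o\<^sub>L T o\<^sub>L \<psi>1 Q = 0}"
    then obtain \<psi> where \<psi>: "\<psi> \<in> Lat_perp (alg_B M) \<rightarrow> Lat (alg_A M)"
      "M = {T \<in> bounded_ops. \<forall>Q\<in>Lat_perp (alg_B M). Q o\<^sub>L T o\<^sub>L \<psi> Q = 0}"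
      by blast
    show "reflexive_space M"
    proof (rule reflexive_if_eq_Op)
      show "M = Op ((\<lambda>Q. (\<psi> Q, Q)) ` Lat_perp (alg_B M))"
        by (rule trans[OF \<psi>(2)]) (simp add: Op_def)
      show "(\<lambda>Q. (\<psi> Q, Q)) ` Lat_perp (alg_B M) \<subseteq> projections \<times> projections"
        using \<psi>(1) projs by blast
    qed
  next
    assume "\<exists>\<psi>2. \<psi>2 \<in> Lat (alg_A M) \<rightarrow> Lat_perp (alg_B M) \<and>
        (\<forall>(P, Q)\<in>Bil M. Q \<sqsubseteq> \<psi>2 P) \<and>
        M = {T \<in> bounded_ops. \<forall>P\<in>Lat (alg_A M). \<psi>2 P o\<^sub>L T o\<^sub>L P = 0}"
    then obtain \<psi> where \<psi>: "\<psi> \<in> Lat (alg_A M) \<rightarrow> Lat_perp (alg_B M)"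
      "M = {T \<in> bounded_ops. \<forall>P\<in>Lat (alg_A M). \<psi> P o\<^sub>L T o\<^sub>L P = 0}"
      by blast
    show "reflexive_space M"
    proof (rule reflexive_if_eq_Op)
      show "M = Op ((\<lambda>P. (P, \<psi> P)) ` Lat (alg_A M))"
        by (rule trans[OF \<psi>(2)]) (simp add: Op_def)
      show "(\<lambda>P. (P, \<psi> P)) ` Lat (alg_A M) \<subseteq> projections \<times> projections"
        using \<psi>(1) projs by blast
    qed
  }
qed

end
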